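(* Let $\Lambda$ be a partially ordered set in which any two elements having a common lower bound have a meet and a common upper bound. Then for every finite nonempty subset $Y\subseteq\Lambda^{*}$, $Y^{\nabla\Delta}=[Y]$. If, in addition, $\Lambda$ is well-founded, then the (MacNeille) closed upper sets of $\Lambda^{*}$ are exactly the stable upper sets.
   Context: $\Lambda^{*}$ is the set of finite words over $\Lambda$ including the empty word, with concatenation, ordered by: $\alpha_1\cdots\alpha_m\le\beta_1\cdots\beta_n$ iff there are $1\le i_1<\dots<i_m\le n$ with $\alpha_j\le\beta_{i_j}$ for all $j$. An upper set is a subset $Z$ with $z\in Z, z\le y\Rightarrow y\in Z$. For $X\subseteq\Lambda^*$, $X^{\Delta}=\{y: x\le y\ \forall x\in X\}$, $X^{\nabla}=\{w: w\le x\ \forall x\in X\}$ (with $\emptyset^\Delta=\emptyset^\nabla=\Lambda^*$), $X^{\nabla\Delta}=(X^\nabla)^\Delta$; an upper set $Z$ is closed if $Z=Z^{\nabla\Delta}$. Two letters are compatible if they have a common lower bound, incompatible otherwise. An upper set $Z$ is stable if it obeys, for all words $y,z$: (cancellation) $y\alpha z, y\beta z\in Z$ with $\alpha,\beta$ incompatible implies $yz\in Z$; (reduction) $y\alpha\alpha z, y\gamma z\in Z$ with $\alpha<\gamma$ implies $y\alpha z\in Z$; (permutation) $y\alpha\beta z, y\gamma z\in Z$ with $\alpha,\beta$ incomparable and $\alpha,\beta<\gamma$ implies $y\beta\alpha z\in Z$; (meet) $y\alpha z, y\beta z\in Z$ with $\alpha,\beta$ incomparable having a meet $\alpha\wedge\beta$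 implies $y(\alpha\wedge\beta)z\in Z$. For $Y\subseteq\Lambda^*$, $[Y]$ denotes the smallest stable upper set containing $Y$. Well-founded: no infinite strictly decreasing sequence. *)

theory Defs
  imports Main "HOL-Library.Sublist"
begin

text \<open>
  The partially ordered set \<open>\<Lambda>\<close> is a type of class \<open>order\<close>, and \<open>\<Lambda>\<^sup>*\<close> is the type
  of lists over it. In particular \<open>\<Lambda>\<close> is nonempty. The equality of closed and stable upper sets
  needs this: for empty \<open>\<Lambda>\<close> the only word is the empty one, and the empty upper set is
  stable but not closed.
\<close>

definition word_le :: "'a::order list \<Rightarrow> 'a list \<Rightarrow> bool" (infix "\<preceq>" 50) where
  "u \<preceq> v \<longleftrightarrow>
     (\<exists>i. strict_mono_on {..<length u} i \<and>
          (\<forall>j<length u. i j < length v \<and> u ! j \<le> v ! i j))"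

definition upper_set :: "'a::order list set \<Rightarrow> bool" where
  "upper_set Z \<longleftrightarrow> (\<forall>z y. z \<in> Z \<longrightarrow> z \<preceq> y \<longrightarrow> y \<in> Z)"

definition upper_bounds :: "'a::order list set \<Rightarrow> 'a list set" ("_\<^sup>\<Delta>" [1000] 999) where
  "X\<^sup>\<Delta> = {y. \<forall>x\<in>X. x \<preceq> y}"

definition lower_bounds :: "'a::order list set \<Rightarrow> 'a list set" ("_\<^sup>\<nabla>" [1000] 999) where
  "X\<^sup>\<nabla> = {w. \<forall>x\<in>X. w \<preceq> x}"

definition macneille_closed :: "'a::order list set \<Rightarrow> bool" where
  "macneille_closed Z \<longleftrightarrow> upper_set Z \<and> Z = (Z\<^sup>\<nabla>)\<^sup>\<Delta>"

definition compatible :: "'a::order \<Rightarrow> 'a \<Rightarrow> bool" where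
  "compatible a b \<longleftrightarrow> (\<exists>c. c \<le> a \<and> c \<le> b)"

definition incomparable :: "'a::order \<Rightarrow> 'a \<Rightarrow> bool" where
  "incomparable a b \<longleftrightarrow> \<not> a \<le> b \<and> \<not> b \<le> a"

definition is_meet :: "'a::order \<Rightarrow> 'a \<Rightarrow> 'a \<Rightarrow> bool" where
  "is_meet a b m \<longleftrightarrow> m \<le> a \<and> m \<le> b \<and> (\<forall>c. c \<le> a \<longrightarrow> c \<le> b \<longrightarrow> c \<le> m)"

definition cancellation :: "'a::order list set \<Rightarrow> bool" where
  "cancellation Z \<longleftrightarrow>
     (\<forall>y z a b. y @ [a] @ z \<in> Z \<longrightarrow> y @ [b] @ z \<in> Z \<longrightarrow> \<not> compatible a b \<longrightarrow> y @ z \<in> Z)"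

definition reduction :: "'a::order list set \<Rightarrow> bool" where
  "reduction Z \<longleftrightarrow>
     (\<forall>y z a c. y @ [a, a] @ z \<in> Z \<longrightarrow> y @ [c] @ z \<in> Z \<longrightarrow> a < c \<longrightarrow> y @ [a] @ z \<in> Z)"

definition permutation :: "'a::order list set \<Rightarrow> bool" where
  "permutation Z \<longleftrightarrow>
     (\<forall>y z a b c. y @ [a, b] @ z \<in> Z \<longrightarrow> y @ [c] @ z \<in> Z \<longrightarrow>
        incomparable a b \<longrightarrow> a < c \<longrightarrow> b < c \<longrightarrow> y @ [b, a] @ z \<in> Z)"

definition meet_rule :: "'a::order list set \<Rightarrow> bool" where
  "meet_rule Z \<longleftrightarrow>
     (\<forall>y z a b m. y @ [a] @ z \<in> Z \<longrightarrow> y @ [b] @ z \<in> Z \<longrightarrow>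
        incomparable a b \<longrightarrow> is_meet a b m \<longrightarrow> y @ [m] @ z \<in> Z)"

definition stable_upper_set :: "'a::order list set \<Rightarrow> bool" where
  "stable_upper_set Z \<longleftrightarrow> upper_set Z \<and> cancellation Z \<and> reduction Z \<and> permutation Z \<and> meet_rule Z"

definition stable_hull :: "'a::order list set \<Rightarrow> 'a list set" where
  "stable_hull Y = \<Inter>{Z. stable_upper_set Z \<and> Y \<subseteq> Z}"

lemma stable_upper_set_Inter:
  assumes "\<And>Z. Z \<in> \<Z> \<Longrightarrow> stable_upper_set Z"
  shows "stable_upper_set (\<Inter>\<Z>)"
proof -
  have "upper_set (\<Inter>\<Z>)"
    using assms unfolding stable_upper_set_def upper_set_def by blast
  moreover have "cancellation (\<Inter>\<Z>)"
    using assms unfolding stable_upper_set_def cancellation_def by (meson InterE InterI)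
  moreover have "reduction (\<Inter>\<Z>)"
    using assms unfolding stable_upper_set_def reduction_def by (meson InterE InterI)
  moreover have "permutation (\<Inter>\<Z>)"
    using assms unfolding stable_upper_set_def permutation_def by (meson InterE InterI)
  moreover have "meet_rule (\<Inter>\<Z>)"
    using assms unfolding stable_upper_set_def meet_rule_def by (meson InterE InterI)
  ultimately show ?thesis
    by (simp add: stable_upper_set_def)
qed

lemma stable_hull_least:
  "stable_upper_set (stable_hull Y)" "Y \<subseteq> stable_hull Y"
  "stable_upper_set Z \<Longrightarrow> Y \<subseteq> Z \<Longrightarrow> stable_hull Y \<subseteq> Z"
  unfolding stable_hull_def by (auto intro: stable_upper_set_Inter)

lemma word_le_iff_list_emb: "u \<preceq> v \<longleftrightarrow> list_emb (\<le>) u v"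
proof
  assume "list_emb (\<le>) u v"
  then show "u \<preceq> v"
  proof induction
    case (list_emb_Nil ys)
    show ?case by (simp add: word_le_def strict_mono_on_def)
  next
    case (list_emb_Cons xs ys y)
    then obtain i where i: "strict_mono_on {..<length xs} i"
      "\<forall>j<length xs. i j < length ys \<and> xs ! j \<le> ys ! i j"
      by (auto simp: word_le_def)
    show ?case unfolding word_le_def
      using i by (intro exI[of _ "\<lambda>j. Suc (i j)"]) (auto simp: strict_mono_on_def)
  next
    case (list_emb_Cons2 x y xs ys)
    then obtain i where i: "strict_mono_on {..<length xs} i"
      "\<forall>j<length xs. i j < length ys \<and> xs ! j \<le> ys ! i j"
      by (auto simp: word_le_def)
    show ?case unfolding word_le_def
      using i \<open>x \<le> y\<close>
      by (intro exI[of _ "\<lambda>j. case j of 0 \<Rightarrow> 0 | Suc k \<Rightarrow> Suc (i k)"])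
        (auto simp: strict_mono_on_def less_Suc_eq_0_disj split: nat.splits)
  qed
next
  assume "u \<preceq> v"
  then show "list_emb (\<le>) u v"
  proof (induction u arbitrary: v)
    case Nil
    show ?case by simp
  next
    case (Cons x xs)
    then obtain i where mono: "strict_mono_on {..<Suc (length xs)} i"
      and le: "\<forall>j<Suc (length xs). i j < length v \<and> (x # xs) ! j \<le> v ! i j"
      by (auto simp: word_le_def)
    define n where "n = i 0"
    have n: "n < length v" "x \<le> v ! n"
      using le by (auto simp: n_def)
    have gt: "n < i (Suc j)" if "j < length xs" for j
      using mono that by (auto simp: strict_mono_on_def n_def)
    have "xs \<preceq> drop (Suc n) v"
      unfolding word_le_def
    proof (intro exI[of _ "\<lambda>j. i (Suc j) - Suc n"] conjI allI impI)
      show "strict_mono_on {..<length xs} (\<lambda>j. i (Suc j) - Suc n)"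
      proof (rule strict_mono_onI)
        fix r s assume rs: "r \<in> {..<length xs}" "s \<in> {..<length xs}" "r < s"
        then have "i (Suc r) < i (Suc s)"
          using mono by (auto simp: strict_mono_on_def)
        with gt[of r] gt[of s] rs show "i (Suc r) - Suc n < i (Suc s) - Suc n"
          by auto
      qed
    next
      fix j assume j: "j < length xs"
      then have b: "i (Suc j) < length v" "xs ! j \<le> v ! i (Suc j)"
        using le by auto
      then show "i (Suc j) - Suc n < length (drop (Suc n) v)"
        using gt[OF j] by auto
      show "xs ! j \<le> drop (Suc n) v ! (i (Suc j) - Suc n)"
        using gt[OF j] b by auto
    qed
    then have "list_emb (\<le>) xs (drop (Suc n) v)"
      by (rule Cons.IH)
    then have "list_emb (\<le>) (x # xs) (v ! n # drop (Suc n) v)"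
      using n by blast
    then have "list_emb (\<le>) (x # xs) (take n v @ v ! n # drop (Suc n) v)"
      by (rule list_emb_append2)
    then show ?case
      using n by (simp add: id_take_nth_drop[symmetric])
  qed
qed

end

theory Submission
  imports Defs
begin

text \<open>
  Every principal upper set is stable, hence so is every closed one. Conversely, let \<open>Z\<close> be stable,
  \<open>Y \<subseteq> Z\<close> finite and nonempty, and \<open>w\<close> above all lower bounds of \<open>Y\<close>; we show \<open>w \<in> Z\<close> by induction on the
  total length of \<open>Y\<close>. Deleting the first letter \<open>a\<close> of one word of \<open>Y\<close> and passing to the residual
  \<open>{y. a # y \<in> Z}\<close>, which is again stable, gives \<open>a # w \<in> Z\<close> for all first letters \<open>a\<close>. Cancellation
  yields \<open>w \<in> Z\<close> unless the first letters have a common lower bound \<open>m\<close>; in that case they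
  have a common upper bound \<open>c\<close>, the meet rule yields \<open>m # w \<in> Z\<close>, and the first letter \<open>d \<ge> m\<close>
  of \<open>w\<close> splits it as \<open>w\<^sub>1 d w\<^sub>2\<close>. Deleting all first letters gives \<open>c # w\<^sub>2 \<in> Z\<close>, and with its help
  reduction and permutation move \<open>m\<close> through \<open>w\<^sub>1\<close> until \<open>d\<close> absorbs it.

  For well-founded \<open>\<Lambda>\<close> the general case reduces to the finite one, because the common lower
  bounds of two words form a finitely generated lower set and the word order is well-founded.
\<close>

section \<open>The order on words\<close>

lemma word_le_Nil [simp]: "[] \<preceq> v"
  by (simp add: word_le_iff_list_emb)

lemma word_le_Nil_right [simp]: "u \<preceq> [] \<longleftrightarrow> u = []"
  by (auto simp: word_le_iff_list_emb)

lemma word_le_refl [simp]: "u \<preceq> u"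
  by (simp add: word_le_iff_list_emb list_emb_refl)

lemma word_le_trans: "u \<preceq> v \<Longrightarrow> v \<preceq> w \<Longrightarrow> u \<preceq> w"
  unfolding word_le_iff_list_emb by (rule list_emb_trans) auto

lemma word_le_append_left: "u \<preceq> v \<Longrightarrow> u \<preceq> y @ v"
  by (simp add: word_le_iff_list_emb list_emb_append2)

lemma word_le_Cons_right: "u \<preceq> v \<Longrightarrow> u \<preceq> a # v"
  by (auto simp: word_le_iff_list_emb)

lemma word_le_Cons_mono: "a \<le> b \<Longrightarrow> u \<preceq> v \<Longrightarrow> a # u \<preceq> b # v"
  by (auto simp: word_le_iff_list_emb)

lemma word_le_ConsD: "a # u \<preceq> v \<Longrightarrow> u \<preceq> v"
  using word_le_trans word_le_Cons_right word_le_refl by blast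

text \<open>Greedy matching is never worse: if \<open>a \<le> b\<close>, an embedding of
  \<open>a # u\<close> into \<open>v\<close> restricts to one of \<open>u\<close>. Comparison thus
  becomes deterministic, which lets simplification settle the case analyses below.\<close>

lemma word_le_Cons_Cons:
  "a # u \<preceq> b # v \<longleftrightarrow> (if a \<le> b then u \<preceq> v else a # u \<preceq> v)"
proof -
  have "a # u \<preceq> b # v \<longleftrightarrow> a # u \<preceq> v \<or> a \<le> b \<and> u \<preceq> v"
    unfolding word_le_iff_list_emb
    by (auto elim: list_emb.cases)
  then show ?thesis
    using word_le_ConsD by auto
qed

lemma word_le_skip_prefix:
  assumes "\<forall>d\<in>set w1. \<not> m \<le> d" "m # x \<preceq> w1 @ w2"
  shows "m # x \<preceq> w2"
  using assms by (induction w1) (auto simp: word_le_Cons_Cons)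

lemma word_le_singleton_split:
  assumes "[m] \<preceq> w"
  obtains w1 d w2 where "w = w1 @ d # w2" "m \<le> d" "\<forall>e\<in>set w1. \<not> m \<le> e"
proof -
  have "\<exists>d\<in>set w. m \<le> d"
    using assms by (induction w) (auto simp: word_le_Cons_Cons split: if_splits)
  then show ?thesis
    using split_list_first_prop_iff[of w "\<lambda>d. m \<le> d"] that by blast
qed

text \<open>Greedy matching consumes the same part of \<open>x\<close> along \<open>y\<close> in
  both hypotheses, so the four stability rules need checking only for an empty prefix.\<close>

lemma word_le_prefix_rule:
  assumes "\<And>x. x \<preceq> p \<Longrightarrow> x \<preceq> q \<Longrightarrow> x \<preceq> r"
    and "x \<preceq> y @ p" "x \<preceq> y @ q"
  shows "x \<preceq> y @ r"
  using assms(2,3)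
proof (induction y arbitrary: x)
  case Nil
  then show ?case using assms(1) by simp
next
  case (Cons e y)
  then show ?case
    by (cases x) (auto simp: word_le_Cons_Cons split: if_splits)
qed

section \<open>Closed upper sets are stable\<close>

text \<open>Once the prefix is stripped, the first letter of \<open>x\<close> decides. In
  cancellation it cannot lie below both \<open>a\<close> and \<open>b\<close>, so one hypothesis
  already embeds \<open>x\<close> into \<open>z\<close>. In reduction and permutation, a letter
  below \<open>a\<close> or \<open>b\<close> is below \<open>c\<close>, so the rest embeds into
  \<open>z\<close>.\<close>

lemma stable_upper_set_principal: "stable_upper_set {y. x \<preceq> y}"
  unfolding stable_upper_set_def
proof (intro conjI)
  show "upper_set {y. x \<preceq> y}"
    by (auto simp: upper_set_def intro: word_le_trans)
  show "cancellation {y. x \<preceq> y}"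
    unfolding cancellation_def
  proof (intro allI impI, simp only: mem_Collect_eq)
    fix y z :: "'a list" and a b
    assume *: "x \<preceq> y @ [a] @ z" "x \<preceq> y @ [b] @ z" "\<not> compatible a b"
    show "x \<preceq> y @ z"
    proof (rule word_le_prefix_rule[OF _ *(1,2)])
      fix x assume "x \<preceq> [a] @ z" "x \<preceq> [b] @ z"
      then show "x \<preceq> z"
        using *(3) by (cases x) (auto simp: word_le_Cons_Cons compatible_def split: if_splits)
    qed
  qed
  show "reduction {y. x \<preceq> y}"
    unfolding reduction_def
  proof (intro allI impI, simp only: mem_Collect_eq)
    fix y z :: "'a list" and a c
    assume *: "x \<preceq> y @ [a, a] @ z" "x \<preceq> y @ [c] @ z" "a < c"
    show "x \<preceq> y @ [a] @ z"
    proof (rule word_le_prefix_rule[OF _ *(1,2)])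
      fix x assume "x \<preceq> [a, a] @ z" "x \<preceq> [c] @ z"
      then show "x \<preceq> [a] @ z"
        using *(3) by (cases x) (auto simp: word_le_Cons_Cons split: if_splits)
    qed
  qed
  show "permutation {y. x \<preceq> y}"
    unfolding permutation_def
  proof (intro allI impI, simp only: mem_Collect_eq)
    fix y z :: "'a list" and a b c
    assume *: "x \<preceq> y @ [a, b] @ z" "x \<preceq> y @ [c] @ z" "a < c" "b < c"
    show "x \<preceq> y @ [b, a] @ z"
    proof (rule word_le_prefix_rule[OF _ *(1,2)])
      fix x assume "x \<preceq> [a, b] @ z" "x \<preceq> [c] @ z"
      then show "x \<preceq> [b, a] @ z"
        using *(3,4)
        by (cases x) (auto simp: word_le_Cons_Cons word_le_Cons_right split: if_splits)
    qed
  qed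
  show "meet_rule {y. x \<preceq> y}"
    unfolding meet_rule_def
  proof (intro allI impI, simp only: mem_Collect_eq)
    fix y z :: "'a list" and a b m
    assume *: "x \<preceq> y @ [a] @ z" "x \<preceq> y @ [b] @ z" "is_meet a b m"
    show "x \<preceq> y @ [m] @ z"
    proof (rule word_le_prefix_rule[OF _ *(1,2)])
      fix x assume "x \<preceq> [a] @ z" "x \<preceq> [b] @ z"
      then show "x \<preceq> [m] @ z"
        using *(3) by (cases x) (auto simp: word_le_Cons_Cons is_meet_def split: if_splits)
    qed
  qed
qed

lemma stable_upper_set_upper_bounds: "stable_upper_set (X\<^sup>\<Delta>)"
proof -
  have "X\<^sup>\<Delta> = \<Inter>((\<lambda>x. {y. x \<preceq> y}) ` X)"
    by (auto simp: upper_bounds_def)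
  then show ?thesis
    using stable_upper_set_Inter[of "(\<lambda>x. {y. x \<preceq> y}) ` X"] stable_upper_set_principal by auto
qed

lemma subset_lower_upper_bounds: "Y \<subseteq> (Y\<^sup>\<nabla>)\<^sup>\<Delta>"
  by (auto simp: upper_bounds_def lower_bounds_def)

section \<open>Finitely generated closures\<close>

lemma stable_upperD: "stable_upper_set Z \<Longrightarrow> z \<in> Z \<Longrightarrow> z \<preceq> y \<Longrightarrow> y \<in> Z"
  by (auto simp: stable_upper_set_def upper_set_def)

lemma stable_Cons: "stable_upper_set Z \<Longrightarrow> z \<in> Z \<Longrightarrow> a # z \<in> Z"
  by (rule stable_upperD) (auto intro: word_le_Cons_right)

lemma stable_Cons_mono: "stable_upper_set Z \<Longrightarrow> a # z \<in> Z \<Longrightarrow> a \<le> b \<Longrightarrow> b # z \<in> Z"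
  by (rule stable_upperD) (auto intro: word_le_Cons_mono)

lemma stable_cancel:
  "stable_upper_set Z \<Longrightarrow> y @ a # z \<in> Z \<Longrightarrow> y @ b # z \<in> Z \<Longrightarrow> \<not> compatible a b \<Longrightarrow> y @ z \<in> Z"
  unfolding stable_upper_set_def cancellation_def by simp

lemma stable_reduce:
  assumes "stable_upper_set Z" "a # a # z \<in> Z" "c # z \<in> Z" "a \<le> c"
  shows "a # z \<in> Z"
proof (cases "a = c")
  case False
  with assms have "a < c" by simp
  with assms(1-3) show ?thesis
    unfolding stable_upper_set_def reduction_def
    by (metis append_Cons append_Nil)
qed (use assms in simp)

lemma stable_permute:
  assumes "stable_upper_set Z" "a # b # z \<in> Z" "c # z \<in> Z" "incomparable a b" "a \<le> c" "b \<le> c"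
  shows "b # a # z \<in> Z"
proof -
  \<comment> \<open>Equality \<open>a = c\<close> would give \<open>b \<le> a\<close>, against
    incomparability; likewise for \<open>b\<close>.\<close>
  have "a < c" "b < c"
    using assms(4-6) by (auto simp: incomparable_def less_le)
  with assms(1-4) show ?thesis
    unfolding stable_upper_set_def permutation_def
    by (metis append_Cons append_Nil)
qed

lemma stable_meet:
  assumes "stable_upper_set Z" "a # z \<in> Z" "b # z \<in> Z" "is_meet a b m"
  shows "m # z \<in> Z"
proof (cases "incomparable a b")
  case True
  with assms show ?thesis
    unfolding stable_upper_set_def meet_rule_def
    by (metis append_Cons append_Nil)
next
  case False
  then have "m = a \<or> m = b"
    using assms(4) by (auto simp: incomparable_def is_meet_def intro: order.antisym)
  with assms show ?thesis by auto
qed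

text \<open>Every rule allows an arbitrary prefix, so \<open>a\<close> can be made part of
  it.\<close>

lemma stable_residual:
  assumes "stable_upper_set Z"
  shows "stable_upper_set {y. a # y \<in> Z}"
proof -
  have "upper_set {y. a # y \<in> Z}"
    using assms by (auto simp: upper_set_def intro: stable_upperD word_le_Cons_mono)
  moreover have "cancellation {y. a # y \<in> Z}"
    using assms unfolding stable_upper_set_def cancellation_def mem_Collect_eq append_Cons[symmetric]
    by blast
  moreover have "reduction {y. a # y \<in> Z}"
    using assms unfolding stable_upper_set_def reduction_def mem_Collect_eq append_Cons[symmetric]
    by blast
  moreover have "permutation {y. a # y \<in> Z}"
    using assms unfolding stable_upper_set_def permutation_def mem_Collect_eq append_Cons[symmetric]
    by blast
  moreover have "meet_rule {y. a # y \<in> Z}"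
    using assms unfolding stable_upper_set_def meet_rule_def mem_Collect_eq append_Cons[symmetric]
    by blast
  ultimately show ?thesis
    by (simp add: stable_upper_set_def)
qed

text \<open>Each step of the induction on \<open>w1\<close> moves \<open>m\<close> past one letter
  \<open>e\<close> and continues in the residual by \<open>e\<close>. The word \<open>c # w2\<close>
  supplies the second hypothesis of reduction and permutation, the one with a single larger
  letter.\<close>

lemma stable_absorb:
  fixes Z :: "'a::order list set"
  assumes up: "\<And>a b :: 'a. compatible a b \<Longrightarrow> \<exists>u. a \<le> u \<and> b \<le> u"
    and "stable_upper_set Z" "m # w1 @ d # w2 \<in> Z" "c # w2 \<in> Z" "m \<le> c" "m \<le> d"
  shows "w1 @ d # w2 \<in> Z"
  using assms(2-)
proof (induction w1 arbitrary: Z)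
  case Nil
  have "compatible c d"
    using Nil.prems by (auto simp: compatible_def)
  then obtain u where "c \<le> u" "d \<le> u"
    using up by blast
  moreover have "d # d # w2 \<in> Z"
    using Nil.prems by (auto intro: stable_Cons_mono)
  ultimately show ?case
    using Nil.prems stable_reduce stable_Cons_mono by (metis append_Nil)
next
  case (Cons e w1)
  let ?r = "w1 @ d # w2"
  note Z = Cons.prems(1)
  have c: "c # ?r \<in> Z"
    by (rule stable_upperD[OF Z Cons.prems(3)])
      (auto intro!: word_le_Cons_mono word_le_append_left intro: word_le_Cons_right)
  have me: "m # e # ?r \<in> Z"
    using Cons.prems by simp
  \<comment> \<open>If \<open>e\<close> and \<open>c\<close> are incompatible, cancellation deletes
    \<open>e\<close>. Otherwise a common upper bound \<open>u\<close> of \<open>e\<close> and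
    \<open>c\<close> also bounds \<open>m\<close>, and reduction or permutation applies with the
    help of \<open>u # ?r\<close>.\<close>
  have "e # m # ?r \<in> Z"
  proof (cases "compatible e c")
    case False
    have "[m] @ e # ?r \<in> Z" "[m] @ c # ?r \<in> Z"
      using me stable_Cons[OF Z c] by auto
    from stable_cancel[OF Z this False] have "m # ?r \<in> Z"
      by simp
    then show ?thesis by (rule stable_Cons[OF Z])
  next
    case True
    then obtain u where u: "e \<le> u" "c \<le> u"
      using up by blast
    have ur: "u # ?r \<in> Z"
      using stable_Cons_mono[OF Z c u(2)] .
    consider "m \<le> e" | "e \<le> m" | "incomparable m e"
      by (auto simp: incomparable_def)
    then show ?thesis
    proof cases
      case 1
      have "e # ?r \<in> Z"
        using stable_reduce[OF Z stable_Cons_mono[OF Z me 1] ur u(1)] .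
      then show ?thesis
        by (rule stable_upperD[OF Z]) (simp add: word_le_Cons_mono word_le_Cons_right)
    next
      case 2
      have "m # m # ?r \<in> Z"
        by (rule stable_upperD[OF Z me]) (auto intro!: word_le_Cons_mono 2)
      then have "m # ?r \<in> Z"
        using stable_reduce[OF Z _ ur] u Cons.prems by force
      then show ?thesis by (rule stable_Cons[OF Z])
    next
      case 3
      then show ?thesis
        using stable_permute[OF Z me ur] u Cons.prems by force
    qed
  qed
  then have "w1 @ d # w2 \<in> {y. e # y \<in> Z}"
    using Cons.prems by (intro Cons.IH) (auto intro: stable_residual stable_Cons)
  then show ?case by simp
qed

text \<open>Letters are added one at a time. If the new letter \<open>a\<close> is incompatible with
  \<open>m\<close>, cancellation gives \<open>w\<close>. Otherwise \<open>m\<close> is replaced by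
  its meet with \<open>a\<close>; this meet lies below both \<open>c\<close> and \<open>a\<close>,
  so these have a common upper bound, which replaces \<open>c\<close>.\<close>

lemma stable_first_letters:
  fixes Z :: "'a::order list set"
  assumes mu: "\<And>a b :: 'a. compatible a b \<Longrightarrow> (\<exists>m. is_meet a b m) \<and> (\<exists>u. a \<le> u \<and> b \<le> u)"
    and Z: "stable_upper_set Z" and A: "finite A" "A \<noteq> {}" "\<forall>a\<in>A. a # w \<in> Z"
  shows "w \<in> Z \<or> (\<exists>m c. m # w \<in> Z \<and> (\<forall>a\<in>A. m \<le> a \<and> a \<le> c))"
  using A
proof (induction rule: finite_ne_induct)
  case (singleton a)
  then show ?case by auto
next
  case (insert a A)
  then consider "w \<in> Z" | m c where "m # w \<in> Z" "\<forall>a\<in>A. m \<le> a \<and> a \<le> c"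
    by auto
  then show ?case
  proof cases
    case 2
    show ?thesis
    proof (cases "compatible m a")
      case True
      then obtain k where k: "is_meet m a k"
        using mu by blast
      then have "compatible c a"
        using 2 \<open>A \<noteq> {}\<close> by (force simp: compatible_def is_meet_def)
      then obtain u where "c \<le> u" "a \<le> u"
        using mu by blast
      moreover have "k # w \<in> Z"
        using stable_meet[OF Z _ _ k] 2 insert.prems by auto
      moreover have "k \<le> m" "k \<le> a"
        using k by (auto simp: is_meet_def)
      ultimately have "k # w \<in> Z \<and> (\<forall>x\<in>insert a A. k \<le> x \<and> x \<le> u)"
        using 2(2) by (simp add: order.trans[of k m] order.trans[of _ c u])
      then show ?thesis by blast
    next
      case False
      then show ?thesis
        using stable_cancel[OF Z, of "[]" m w a] 2(1) insert.prems by simp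
    qed
  qed simp
qed

text \<open>\<open>Z\<close> and \<open>w\<close> vary in the induction: both recursive calls
  replace \<open>Z\<close> by a residual, and the second one also replaces \<open>w\<close> by its
  suffix \<open>w2\<close>.\<close>

lemma stable_contains_finite_closure:
  fixes Z :: "'a::order list set"
  assumes mu: "\<And>a b :: 'a. compatible a b \<Longrightarrow> (\<exists>m. is_meet a b m) \<and> (\<exists>u. a \<le> u \<and> b \<le> u)"
    and "stable_upper_set Z" "finite Y" "Y \<noteq> {}" "Y \<subseteq> Z" "w \<in> (Y\<^sup>\<nabla>)\<^sup>\<Delta>"
  shows "w \<in> Z"
  using assms(2-)
proof (induction "sum length Y" arbitrary: Y Z w rule: less_induct)
  case less
  note Z = less.prems(1) and Y = less.prems(2-4)
  have w: "x \<preceq> w" if "\<And>u. u \<in> Y \<Longrightarrow> x \<preceq> u" for x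
    using less.prems(5) that by (auto simp: upper_bounds_def lower_bounds_def)
  show ?case
  proof (cases "[] \<in> Y")
    case True
    then show ?thesis
      using Y stable_upperD[OF Z, of "[]"] by auto
  next
    case False
    have first: "a # w \<in> Z" if "a # v \<in> Y" for a v
    proof -
      let ?Y = "insert v (Y - {a # v})"
      \<comment> \<open>Only an inequality, since \<open>v\<close> may already belong to
        \<open>Y\<close>.\<close>
      have "sum length ?Y \<le> length v + sum length (Y - {a # v})"
        using Y by (simp add: sum.insert_if)
      also have "\<dots> < sum length Y"
        using Y that by (simp add: sum.remove[of Y "a # v"])
      finally have "w \<in> {y. a # y \<in> Z}"
      proof (rule less.hyps)
        show "stable_upper_set {y. a # y \<in> Z}"
          using Z by (rule stable_residual)
        show "?Y \<subseteq> {y. a # y \<in> Z}"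
          using that Y stable_Cons[OF Z] by auto
        have "x \<preceq> u" if "x \<in> ?Y\<^sup>\<nabla>" "u \<in> Y" for x u
          using that by (cases "u = a # v") (auto simp: lower_bounds_def intro: word_le_Cons_right)
        then show "w \<in> (?Y\<^sup>\<nabla>)\<^sup>\<Delta>"
          using w by (auto simp: upper_bounds_def)
      qed (use Y in auto)
      then show ?thesis by simp
    qed
    have hd_tl: "u = hd u # tl u" if "u \<in> Y" for u
      using that False by (cases u) auto
    have "\<forall>a\<in>hd ` Y. a # w \<in> Z"
      using first hd_tl by (metis imageE)
    then consider "w \<in> Z" | m c where "m # w \<in> Z" "\<forall>u\<in>Y. m \<le> hd u \<and> hd u \<le> c"
      using stable_first_letters[OF mu Z, of "hd ` Y" w] Y by auto
    then show ?thesis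
    proof cases
      case 2
      have mx: "m # x \<preceq> u" if "u \<in> Y" "x \<preceq> tl u" for x u
        by (subst hd_tl[OF that(1)]) (use 2(2) that in \<open>blast intro: word_le_Cons_mono\<close>)
      have "[m] \<preceq> w"
        using mx by (intro w) auto
      then obtain w1 d w2 where split: "w = w1 @ d # w2" "m \<le> d" "\<forall>e\<in>set w1. \<not> m \<le> e"
        by (rule word_le_singleton_split)
      \<comment> \<open>Distinct words may share a tail. The strict decrease comes from every word
        of \<open>Y\<close> being nonempty.\<close>
      have "sum length (tl ` Y) \<le> sum (length \<circ> tl) Y"
        using Y by (intro sum_image_le) auto
      also have "\<dots> < sum length Y"
      proof (rule sum_strict_mono)
        fix u assume "u \<in> Y"
        then show "(length \<circ> tl) u < length u"
          using False by (cases u) auto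
      qed (use Y in auto)
      finally have "w2 \<in> {y. c # y \<in> Z}"
      proof (rule less.hyps)
        show "stable_upper_set {y. c # y \<in> Z}"
          using Z by (rule stable_residual)
        show "tl ` Y \<subseteq> {y. c # y \<in> Z}"
        proof safe
          fix u assume u: "u \<in> Y"
          then have "hd u # tl u \<in> Z"
            using Y(3) hd_tl[OF u] by auto
          then show "c # tl u \<in> Z"
            using stable_Cons_mono[OF Z] 2(2) u by blast
        qed
        \<comment> \<open>Prefixing \<open>m\<close> turns \<open>x\<close> into a lower bound of
          \<open>Y\<close>, hence of \<open>w\<close>. As no letter of \<open>w1\<close> is above
          \<open>m\<close>, greedy matching sends \<open>m\<close> to \<open>d\<close> and leaves
          \<open>x\<close> to be embedded into \<open>w2\<close>.\<close>
        have "x \<preceq> w2" if "x \<in> (tl ` Y)\<^sup>\<nabla>" for x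
        proof -
          have "m # x \<preceq> w"
            using that by (intro w mx) (auto simp: lower_bounds_def)
          then have "m # x \<preceq> d # w2"
            using split word_le_skip_prefix by blast
          then show ?thesis
            using split(2) by (simp add: word_le_Cons_Cons)
        qed
        then show "w2 \<in> ((tl ` Y)\<^sup>\<nabla>)\<^sup>\<Delta>"
          by (simp add: upper_bounds_def)
      qed (use Y in auto)
      moreover have "m \<le> c"
        using 2(2) Y(2) order.trans by blast
      ultimately show ?thesis
        using stable_absorb[OF _ Z, of m w1 d w2 c] mu 2(1) split(1,2) by blast
    qed
  qed
qed

lemma finite_closure_eq_stable_hull:
  fixes Y :: "'a::order list set"
  assumes "\<And>a b :: 'a. compatible a b \<Longrightarrow> (\<exists>m. is_meet a b m) \<and> (\<exists>u. a \<le> u \<and> b \<le> u)"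
    and "finite Y" "Y \<noteq> {}"
  shows "(Y\<^sup>\<nabla>)\<^sup>\<Delta> = stable_hull Y"
proof
  show "(Y\<^sup>\<nabla>)\<^sup>\<Delta> \<subseteq> stable_hull Y"
    using stable_contains_finite_closure[OF assms(1) stable_hull_least(1) assms(2,3) stable_hull_least(2)]
    by auto
  show "stable_hull Y \<subseteq> (Y\<^sup>\<nabla>)\<^sup>\<Delta>"
    by (intro stable_hull_least(3) stable_upper_set_upper_bounds subset_lower_upper_bounds)
qed

section \<open>Well-founded alphabets\<close>

text \<open>A common lower word of \<open>a # u\<close> and \<open>b # v\<close> avoids the first
  letter of one of them, or uses both and then starts with a letter below their meet. The outer
  induction hypothesis holds for every second word; the inner induction keeps \<open>a # u\<close>
  fixed.\<close>

lemma common_lower_words_finitely_generated: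
  fixes u v :: "'a::order list"
  assumes mu: "\<And>a b :: 'a. compatible a b \<Longrightarrow> \<exists>m. is_meet a b m"
  shows "\<exists>G. finite G \<and> (\<forall>x. x \<preceq> u \<and> x \<preceq> v \<longleftrightarrow> (\<exists>g\<in>G. x \<preceq> g))"
proof (induction u arbitrary: v)
  case Nil
  show ?case by (rule exI[of _ "{[]}"]) auto
next
  case (Cons a u)
  note IH_u = Cons.IH
  show ?case
  proof (induction v)
    case Nil
    show ?case by (rule exI[of _ "{[]}"]) auto
  next
    case (Cons b v)
    obtain G1 where G1: "finite G1" "\<And>x. x \<preceq> u \<and> x \<preceq> b # v \<longleftrightarrow> (\<exists>g\<in>G1. x \<preceq> g)"
      using IH_u by metis
    obtain G2 where G2: "finite G2" "\<And>x. x \<preceq> a # u \<and> x \<preceq> v \<longleftrightarrow> (\<exists>g\<in>G2. x \<preceq> g)"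
      using Cons.IH by metis
    obtain G3 where G3: "finite G3" "\<And>x. x \<preceq> u \<and> x \<preceq> v \<longleftrightarrow> (\<exists>g\<in>G3. x \<preceq> g)"
      using IH_u by metis
    \<comment> \<open>\<open>M\<close> holds the meet if there is one and is empty otherwise, which
      treats both cases uniformly.\<close>
    obtain M where M: "finite M" "\<And>c. c \<le> a \<and> c \<le> b \<longleftrightarrow> (\<exists>m\<in>M. c \<le> m)"
    proof (cases "compatible a b")
      case True
      then obtain m where "is_meet a b m"
        using mu by blast
      then have "c \<le> a \<and> c \<le> b \<longleftrightarrow> c \<le> m" for c
        by (auto simp: is_meet_def)
      then show ?thesis
        by (intro that[of "{m}"]) auto
    next
      case False
      then show ?thesis
        by (intro that[of "{}"]) (auto simp: compatible_def)
    qed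
    let ?G = "G1 \<union> G2 \<union> (\<lambda>(m, g). m # g) ` (M \<times> G3)"
    have "x \<preceq> a # u \<and> x \<preceq> b # v \<longleftrightarrow> (\<exists>g\<in>?G. x \<preceq> g)" for x
    proof
      assume x: "x \<preceq> a # u \<and> x \<preceq> b # v"
      show "\<exists>g\<in>?G. x \<preceq> g"
      proof (cases x)
        case Nil
        then show ?thesis using G1(2)[of "[]"] by auto
      next
        case (Cons c y)
        consider "\<not> c \<le> a" | "\<not> c \<le> b" | "c \<le> a" "c \<le> b" by blast
        then show ?thesis
        proof cases
          case 1
          then show ?thesis
            using x Cons G1(2)[of x] by (auto simp: word_le_Cons_Cons)
        next
          case 2
          then show ?thesis
            using x Cons G2(2)[of x] by (auto simp: word_le_Cons_Cons)
        next
          case 3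
          then obtain m g where "m \<in> M" "c \<le> m" "g \<in> G3" "y \<preceq> g"
            using x Cons G3(2)[of y] M(2)[of c] by (auto simp: word_le_Cons_Cons)
          then have "m # g \<in> ?G" "x \<preceq> m # g"
            using Cons by (auto intro: word_le_Cons_mono)
          then show ?thesis by blast
        qed
      qed
    next
      assume "\<exists>g\<in>?G. x \<preceq> g"
      then consider "\<exists>g\<in>G1. x \<preceq> g" | "\<exists>g\<in>G2. x \<preceq> g"
        | m g where "m \<in> M" "g \<in> G3" "x \<preceq> m # g"
        by auto
      then show "x \<preceq> a # u \<and> x \<preceq> b # v"
      proof cases
        case 1
        then show ?thesis using G1(2) word_le_Cons_right by blast
      next
        case 2
        then show ?thesis using G2(2) word_le_Cons_right by blast
      next
        case 3
        have "g \<preceq> u" "g \<preceq> v" "m \<le> a" "m \<le> b"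
          using 3(1,2) G3(2)[of g] M(2)[of m] word_le_refl[of g] order.refl[of m] by metis+
        then show ?thesis
          using 3(3) by (meson word_le_Cons_mono word_le_trans)
      qed
    qed
    moreover have "finite ?G"
      using G1(1) G2(1) G3(1) M(1) by simp
    ultimately show ?case by (intro exI[of _ ?G] conjI allI)
  qed
qed

text \<open>Length-lexicographic order inherits well-foundedness from the letters, so this makes the
  word order well-founded too.\<close>

lemma word_le_imp_lenlex: "u \<preceq> v \<Longrightarrow> u = v \<or> (u, v) \<in> lenlex {(a, b). a < b}"
  unfolding word_le_iff_list_emb
proof (induction rule: list_emb.induct)
  case (list_emb_Nil ys)
  show ?case by (cases ys) auto
next
  case (list_emb_Cons xs ys y)
  then have "length xs < length (y # ys)"
    using list_emb_length by fastforce
  then show ?case by (simp add: lenlex_conv)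
next
  case (list_emb_Cons2 x y xs ys)
  then show ?case by (auto simp: Cons_lenlex_iff less_le lenlex_length)
qed

text \<open>If \<open>f\<close> is not a lower bound of \<open>Z\<close>, some \<open>z\<close> in
  \<open>Z\<close> witnesses this. The words below both \<open>f\<close> and \<open>z\<close> have
  finitely many generators, all strictly below \<open>f\<close>, so their finite test sets together
  with \<open>z\<close> serve for \<open>f\<close>.\<close>

lemma lower_bounds_below_word_finite:
  fixes Z :: "'a::order list set"
  assumes mu: "\<And>a b :: 'a. compatible a b \<Longrightarrow> \<exists>m. is_meet a b m"
    and wf: "wf {(a, b :: 'a). a < b}"
  shows "\<exists>Y. finite Y \<and> Y \<subseteq> Z \<and> (\<forall>x. x \<preceq> f \<longrightarrow> x \<in> Y\<^sup>\<nabla> \<longrightarrow> x \<in> Z\<^sup>\<nabla>)"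
  using wf_lenlex[OF wf]
proof (induction f rule: wf_induct_rule)
  case (less f)
  show ?case
  proof (cases "f \<in> Z\<^sup>\<nabla>")
    case True
    then show ?thesis
      by (intro exI[of _ "{}"]) (auto simp: lower_bounds_def intro: word_le_trans)
  next
    case False
    then obtain z where z: "z \<in> Z" "\<not> f \<preceq> z"
      by (auto simp: lower_bounds_def)
    obtain G where G: "finite G" "\<And>x. x \<preceq> f \<and> x \<preceq> z \<longleftrightarrow> (\<exists>g\<in>G. x \<preceq> g)"
      using common_lower_words_finitely_generated[OF mu] by metis
    have "\<exists>Y. finite Y \<and> Y \<subseteq> Z \<and> (\<forall>x. x \<preceq> g \<longrightarrow> x \<in> Y\<^sup>\<nabla> \<longrightarrow> x \<in> Z\<^sup>\<nabla>)" if "g \<in> G" for g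
    proof (rule less.IH)
      have "g \<preceq> f" "g \<preceq> z"
        using G(2)[of g] that word_le_refl[of g] by blast+
      then show "(g, f) \<in> lenlex {(a, b). a < b}"
        using z(2) word_le_imp_lenlex by blast
    qed
    then obtain Y where Y: "\<And>g. g \<in> G \<Longrightarrow>
        finite (Y g) \<and> Y g \<subseteq> Z \<and> (\<forall>x. x \<preceq> g \<longrightarrow> x \<in> (Y g)\<^sup>\<nabla> \<longrightarrow> x \<in> Z\<^sup>\<nabla>)"
      by metis
    let ?Y = "insert z (\<Union>g\<in>G. Y g)"
    have "x \<in> Z\<^sup>\<nabla>" if x: "x \<preceq> f" "x \<in> ?Y\<^sup>\<nabla>" for x
    proof -
      obtain g where "g \<in> G" "x \<preceq> g"
        using x G(2)[of x] by (auto simp: lower_bounds_def)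
      moreover from this have "x \<in> (Y g)\<^sup>\<nabla>"
        using x by (auto simp: lower_bounds_def)
      ultimately show ?thesis
        using Y by blast
    qed
    moreover have "finite ?Y" "?Y \<subseteq> Z"
      using G(1) Y z(1) by auto
    ultimately show ?thesis by (intro exI[of _ ?Y] conjI allI impI)
  qed
qed

lemma stable_imp_macneille_closed:
  fixes Z :: "'a::order list set"
  assumes mu: "\<And>a b :: 'a. compatible a b \<Longrightarrow> (\<exists>m. is_meet a b m) \<and> (\<exists>u. a \<le> u \<and> b \<le> u)"
    and wf: "wf {(a, b :: 'a). a < b}"
    and Z: "stable_upper_set Z"
  shows "macneille_closed Z"
proof -
  have "(Z\<^sup>\<nabla>)\<^sup>\<Delta> \<subseteq> Z"
  proof (cases "Z = {}")
    case True
    have "w \<notin> (Z\<^sup>\<nabla>)\<^sup>\<Delta>" for w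
    proof
      assume "w \<in> (Z\<^sup>\<nabla>)\<^sup>\<Delta>"
      \<comment> \<open>\<open>undefined\<close> is just some letter: every word is a lower bound of
        the empty set, even one longer than \<open>w\<close>.\<close>
      then have "undefined # w \<preceq> w"
        using True by (auto simp: lower_bounds_def upper_bounds_def)
      then show False
        using list_emb_length by (fastforce simp: word_le_iff_list_emb)
    qed
    then show ?thesis by blast
  next
    case False
    then obtain f where f: "f \<in> Z" by blast
    obtain Y where Y: "finite Y" "Y \<subseteq> Z" "\<And>x. x \<preceq> f \<Longrightarrow> x \<in> Y\<^sup>\<nabla> \<Longrightarrow> x \<in> Z\<^sup>\<nabla>"
      using lower_bounds_below_word_finite[OF _ wf] mu by metis
    \<comment> \<open>Inserting \<open>f\<close> confines the lower bounds to words below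
      \<open>f\<close>, where \<open>Y\<close> decides for all of \<open>Z\<close>.\<close>
    have "(insert f Y)\<^sup>\<nabla> \<subseteq> Z\<^sup>\<nabla>"
      using Y(3) by (auto simp: lower_bounds_def)
    then have "(Z\<^sup>\<nabla>)\<^sup>\<Delta> \<subseteq> ((insert f Y)\<^sup>\<nabla>)\<^sup>\<Delta>"
      by (auto simp: upper_bounds_def)
    also have "\<dots> \<subseteq> Z"
      using stable_contains_finite_closure[OF mu Z, of "insert f Y"] Y f by auto
    finally show ?thesis .
  qed
  then show ?thesis
    using Z subset_lower_upper_bounds[of Z]
    by (auto simp: macneille_closed_def stable_upper_set_def)
qed

theorem theorem4p4:
  assumes "\<And>a b :: 'a::order. compatible a b \<Longrightarrow> (\<exists>m. is_meet a b m) \<and> (\<exists>u. a \<le> u \<and> b \<le> u)"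
  shows "(\<forall>Y :: 'a list set. finite Y \<longrightarrow> Y \<noteq> {} \<longrightarrow> (Y\<^sup>\<nabla>)\<^sup>\<Delta> = stable_hull Y) \<and>
    ((\<nexists>s :: nat \<Rightarrow> 'a. \<forall>n. s (Suc n) < s n) \<longrightarrow>
      (\<forall>Z :: 'a list set. macneille_closed Z \<longleftrightarrow> stable_upper_set Z))"
proof (intro conjI allI impI)
  fix Y :: "'a list set"
  assume "finite Y" "Y \<noteq> {}"
  with assms show "(Y\<^sup>\<nabla>)\<^sup>\<Delta> = stable_hull Y"
    by (rule finite_closure_eq_stable_hull)
next
  fix Z :: "'a list set"
  assume "\<nexists>s :: nat \<Rightarrow> 'a. \<forall>n. s (Suc n) < s n"
  then have "wf {(a, b :: 'a). a < b}"
    by (simp add: wf_iff_no_infinite_down_chain)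
  moreover have "stable_upper_set Z" if "macneille_closed Z"
    using that stable_upper_set_upper_bounds[of "Z\<^sup>\<nabla>"] by (simp add: macneille_closed_def)
  ultimately show "macneille_closed Z \<longleftrightarrow> stable_upper_set Z"
    using stable_imp_macneille_closed[OF assms] by blast
qed

end
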